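(* For all positive integers $n$ we have \[ b(n)>\frac{1}{2}\left(\sqrt{2n+1}-1\right)=\left(\frac{1}{\sqrt{2}}+o(1)\right)n^{1/2}, \] where $o(1)$ denotes a quantity tending to $0$ as $n\to\infty$.
   Context: All bipartite graphs are on a vertex set $A\cup B$ with fixed bipartition $(A,B)$ and $|A|=|B|=n$. For a bipartite graph $H$, $\overline{H}$ denotes its bipartite complement, i.e. the bipartite graph with edge set $\{ab: a\in A,\ b\in B,\ ab\notin E(H)\}$. A perfect matching $M$ in a bipartite graph $G$ is called acceptable for $H$ if no two edges of $M$ form a 4-cycle with two edges of $H$; that is, there are no two distinct edges $(a,b),(a',b')\in M$ with $a,a'\in A$, $b,b'\in B$ such that both $(a,b')$ and $(a',b)$ are edges of $H$. Define $b(n)$ to be the minimum number $s$ such that there exists an $s$-regular bipartite graph $H$ (with parts $A,B$ of size $n$) for which there is no perfect matching in $\overline{H}$ which is acceptable for $H$. *)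

theory Defs
  imports Complex_Main
begin

text \<open>
  A bipartite graph with parts \<open>A\<close> and \<open>B\<close> is given by its edges, each written as the ordered
  pair (end in \<open>A\<close>, end in \<open>B\<close>).  The position in the pair records the side, so \<open>A\<close> and \<open>B\<close>
  are treated as disjoint parts even when they are the same set of labels.
\<close>

definition bipartite_graph :: "'a set \<Rightarrow> 'b set \<Rightarrow> ('a \<times> 'b) set \<Rightarrow> bool" where
  "bipartite_graph A B H \<longleftrightarrow> H \<subseteq> A \<times> B"

definition bipartite_complement :: "'a set \<Rightarrow> 'b set \<Rightarrow> ('a \<times> 'b) set \<Rightarrow> ('a \<times> 'b) set" where
  "bipartite_complement A B H = {(a, b). a \<in> A \<and> b \<in> B \<and> (a, b) \<notin> H}"

definition regular_bipartite_graph :: "'a set \<Rightarrow> 'b set \<Rightarrow> nat \<Rightarrow> ('a \<times> 'b) set \<Rightarrow> bool" where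
  "regular_bipartite_graph A B s H \<longleftrightarrow>
     bipartite_graph A B H \<and>
     (\<forall>a\<in>A. card {b \<in> B. (a, b) \<in> H} = s) \<and>
     (\<forall>b\<in>B. card {a \<in> A. (a, b) \<in> H} = s)"

definition perfect_matching_in :: "'a set \<Rightarrow> 'b set \<Rightarrow> ('a \<times> 'b) set \<Rightarrow> ('a \<times> 'b) set \<Rightarrow> bool" where
  "perfect_matching_in A B G M \<longleftrightarrow>
     M \<subseteq> G \<and> (\<forall>a\<in>A. \<exists>!b. (a, b) \<in> M) \<and> (\<forall>b\<in>B. \<exists>!a. (a, b) \<in> M)"

definition acceptable_for :: "('a \<times> 'b) set \<Rightarrow> ('a \<times> 'b) set \<Rightarrow> bool" where
  "acceptable_for H M \<longleftrightarrow>
     \<not> (\<exists>a b a' b'. (a, b) \<in> M \<and> (a', b') \<in> M \<and> (a, b) \<noteq> (a', b') \<and>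
          (a, b') \<in> H \<and> (a', b) \<in> H)"

definition has_bad_regular_graph :: "nat \<Rightarrow> nat \<Rightarrow> bool" where
  "has_bad_regular_graph n s \<longleftrightarrow>
     (\<exists>H :: (nat \<times> nat) set.
        regular_bipartite_graph {..<n} {..<n} s H \<and>
        \<not> (\<exists>M. perfect_matching_in {..<n} {..<n} (bipartite_complement {..<n} {..<n} H) M \<and>
               acceptable_for H M))"

definition b :: "nat \<Rightarrow> nat" where
  "b n = (LEAST s. has_bad_regular_graph n s)"

text \<open>For positive \<open>n\<close> the minimum is attained: the complete bipartite graph is bad.\<close>

lemma has_bad_regular_graph_complete:
  assumes "n > 0"
  shows "has_bad_regular_graph n n"
  unfolding has_bad_regular_graph_def
proof (intro exI[of _ "{..<n} \<times> {..<n}"] conjI notI)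
  show "regular_bipartite_graph {..<n} {..<n} n ({..<n} \<times> {..<n})"
    by (simp add: regular_bipartite_graph_def bipartite_graph_def flip: lessThan_def)
next
  assume "\<exists>M. perfect_matching_in {..<n} {..<n}
       (bipartite_complement {..<n} {..<n} ({..<n} \<times> {..<n})) M \<and>
     acceptable_for ({..<n} \<times> {..<n}) M"
  then show False
    using assms unfolding perfect_matching_in_def bipartite_complement_def by fastforce
qed

lemma b_attained:
  assumes "n > 0"
  shows "has_bad_regular_graph n (b n)"
  unfolding b_def by (rule LeastI, rule has_bad_regular_graph_complete[OF assms])

end

theory Submission
  imports Defs "HOL-Real_Asymp.Real_Asymp"
begin

text \<open>
  The bound on \<open>b n\<close> amounts to this: if every degree of \<open>H\<close> is at most \<open>s\<close> and
  \<open>2 * s * (s + 1) \<le> n\<close>, then the bipartite complement of \<open>H\<close> has a perfect matching acceptable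
  for \<open>H\<close> (\<open>acceptable_matching_exists\<close>).

  A bijection \<open>\<sigma>\<close> from \<open>A\<close> to \<open>B\<close> turns \<open>H\<close> into a digraph on \<open>A\<close> with an arc \<open>x \<rightarrow> y\<close>
  whenever \<open>(x, \<sigma> y) \<in> H\<close>; its in- and out-degrees are at most \<open>s\<close>.  The matching
  \<open>{(x, \<sigma> x) | x \<in> A}\<close> avoids \<open>H\<close> iff the digraph has no loops, and is moreover acceptable for
  \<open>H\<close> iff the digraph also has no 2-cycles.  Take \<open>\<sigma>\<close> with the fewest loops and 2-cycles in total,
  and suppose that \<open>a\<close> lies on one of them.  At most \<open>s + s\<^sup>2\<close> vertices are reached from \<open>a\<close> by a
  walk of length 1 or 2, at most \<open>s + s\<^sup>2\<close> reach \<open>a\<close> in this way, and \<open>a\<close> itself is of both kinds.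
  So fewer than \<open>2 * s * (s + 1)\<close> vertices are of either kind, and some \<open>c\<close> is of neither.
  Exchanging the values of \<open>\<sigma>\<close> at \<open>a\<close> and \<open>c\<close> destroys every loop and 2-cycle through \<open>a\<close> or \<open>c\<close>
  and changes none of the others.  It creates none, except possibly a 2-cycle on \<open>a\<close> and \<open>c\<close>
  when both of these carried loops (\<open>conflicts_swap\<close>); then two loops are traded for one
  2-cycle.  In either case the total drops, a contradiction.
\<close>

text \<open>
  The loops and 2-cycles of the digraph of \<open>\<sigma>\<close>, each recorded by its vertex set: \<open>{x}\<close> for a
  loop, \<open>{x, y}\<close> for a 2-cycle.  With unordered pairs a 2-cycle counts once, like a loop.
\<close>

definition conflicts :: "'a set \<Rightarrow> ('a \<times> 'b) set \<Rightarrow> ('a \<Rightarrow> 'b) \<Rightarrow> 'a set set" where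
  "conflicts A H \<sigma> = {{x, y} | x y. x \<in> A \<and> y \<in> A \<and> (x, \<sigma> y) \<in> H \<and> (y, \<sigma> x) \<in> H}"

text \<open>The vertices reached from \<open>a\<close> by a walk of length 1 or 2, and those that so reach \<open>a\<close>.\<close>

definition out_walks :: "'a set \<Rightarrow> ('a \<times> 'b) set \<Rightarrow> ('a \<Rightarrow> 'b) \<Rightarrow> 'a \<Rightarrow> 'a set" where
  "out_walks A H \<sigma> a =
     {y \<in> A. (a, \<sigma> y) \<in> H} \<union> (\<Union>x\<in>{x \<in> A. (a, \<sigma> x) \<in> H}. {y \<in> A. (x, \<sigma> y) \<in> H})"

definition in_walks :: "'a set \<Rightarrow> ('a \<times> 'b) set \<Rightarrow> ('a \<Rightarrow> 'b) \<Rightarrow> 'a \<Rightarrow> 'a set" where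
  "in_walks A H \<sigma> a =
     {x \<in> A. (x, \<sigma> a) \<in> H} \<union> (\<Union>y\<in>{y \<in> A. (y, \<sigma> a) \<in> H}. {x \<in> A. (x, \<sigma> y) \<in> H})"

lemma finite_conflicts:
  assumes "finite A"
  shows "finite (conflicts A H \<sigma>)"
proof (rule finite_subset)
  show "conflicts A H \<sigma> \<subseteq> Pow A"
    by (auto simp: conflicts_def)
qed (use assms in simp)

lemma card_Un_UN_le:
  assumes "finite X" and "card X \<le> s" and "\<And>x. x \<in> X \<Longrightarrow> card (F x) \<le> s"
  shows "card (X \<union> (\<Union>x\<in>X. F x)) \<le> s + s * s"
proof -
  have "card (\<Union>x\<in>X. F x) \<le> (\<Sum>x\<in>X. card (F x))"
    by (rule card_UN_le[OF assms(1)])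
  also have "\<dots> \<le> card X * s"
    using sum_bounded_above[of X "\<lambda>x. card (F x)" s] assms(3) by simp
  also have "\<dots> \<le> s * s"
    using assms(2) by (rule mult_right_mono) simp
  finally show ?thesis
    using card_Un_le[of X "\<Union>x\<in>X. F x"] assms(2) by linarith
qed

lemma card_out_walks_le:
  assumes "finite A" and bij: "bij_betw \<sigma> A B" and "a \<in> A"
    and deg: "\<And>x. x \<in> A \<Longrightarrow> card {y \<in> B. (x, y) \<in> H} \<le> s"
  shows "card (out_walks A H \<sigma> a) \<le> s + s * s"
proof -
  have "card {y \<in> A. (x, \<sigma> y) \<in> H} \<le> s" if "x \<in> A" for x
  proof -
    have "bij_betw \<sigma> {y \<in> A. (x, \<sigma> y) \<in> H} {y \<in> B. (x, y) \<in> H}"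
      using bij by (auto simp: bij_betw_def inj_on_def)
    then show ?thesis
      using deg[OF that] by (simp add: bij_betw_same_card)
  qed
  then show ?thesis
    unfolding out_walks_def using assms(1,3) by (intro card_Un_UN_le) auto
qed

lemma card_in_walks_le:
  assumes "finite A" and bij: "bij_betw \<sigma> A B" and "a \<in> A"
    and deg: "\<And>y. y \<in> B \<Longrightarrow> card {x \<in> A. (x, y) \<in> H} \<le> s"
  shows "card (in_walks A H \<sigma> a) \<le> s + s * s"
proof -
  have "card {x \<in> A. (x, \<sigma> y) \<in> H} \<le> s" if "y \<in> A" for y
    using deg[of "\<sigma> y"] bij that by (auto simp: bij_betw_def)
  then show ?thesis
    unfolding in_walks_def using assms(1,3) by (intro card_Un_UN_le) auto
qed

text \<open>
  Exchanging the values at \<open>a\<close> and \<open>c\<close> exchanges their in-neighbourhoods.  A new conflict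
  between \<open>a\<close> and a third vertex \<open>x\<close> would need a walk \<open>a \<rightarrow> x \<rightarrow> c\<close>, a new loop at \<open>a\<close> an arc
  \<open>a \<rightarrow> c\<close>; at \<open>c\<close> the arcs run the other way.  A new 2-cycle on \<open>a\<close> and \<open>c\<close> needs old loops at both.
\<close>

lemma conflicts_swap:
  assumes "a \<in> A" and c: "c \<in> A" "c \<notin> out_walks A H \<sigma> a" "c \<notin> in_walks A H \<sigma> a"
    and "c \<noteq> a"
    and P: "P \<in> conflicts A H (\<sigma>(a := \<sigma> c, c := \<sigma> a))"
  shows "P \<in> conflicts A H \<sigma> \<and> a \<notin> P \<and> c \<notin> P \<or>
         P = {a, c} \<and> (a, \<sigma> a) \<in> H \<and> (c, \<sigma> c) \<in> H"
proof -
  have no_out: "(a, \<sigma> c) \<notin> H" "\<And>x. x \<in> A \<Longrightarrow> (a, \<sigma> x) \<in> H \<Longrightarrow> (x, \<sigma> c) \<notin> H"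
    using c by (auto simp: out_walks_def)
  have no_in: "(c, \<sigma> a) \<notin> H" "\<And>y. y \<in> A \<Longrightarrow> (y, \<sigma> a) \<in> H \<Longrightarrow> (c, \<sigma> y) \<notin> H"
    using c by (auto simp: in_walks_def)
  obtain x y where xy: "P = {x, y}" "x \<in> A" "y \<in> A"
    "(x, (\<sigma>(a := \<sigma> c, c := \<sigma> a)) y) \<in> H" "(y, (\<sigma>(a := \<sigma> c, c := \<sigma> a)) x) \<in> H"
    using P by (auto simp: conflicts_def)
  show ?thesis
  proof (cases "x \<in> {a, c} \<or> y \<in> {a, c}")
    case True
    then show ?thesis
      using xy no_out no_in \<open>c \<noteq> a\<close> by (auto split: if_splits)
  next
    case False
    then show ?thesis
      using xy by (auto simp: conflicts_def)
  qed
qed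

lemma swap_reduces_conflicts:
  assumes fin: "finite A" and bij: "bij_betw \<sigma> A B"
    and degA: "\<And>x. x \<in> A \<Longrightarrow> card {y \<in> B. (x, y) \<in> H} \<le> s"
    and degB: "\<And>y. y \<in> B \<Longrightarrow> card {x \<in> A. (x, y) \<in> H} \<le> s"
    and large: "2 * s * (s + 1) \<le> card A"
    and ne: "conflicts A H \<sigma> \<noteq> {}"
  shows "\<exists>\<tau>. bij_betw \<tau> A B \<and> card (conflicts A H \<tau>) < card (conflicts A H \<sigma>)"
proof -
  obtain a a' where a: "a \<in> A" "a' \<in> A" "(a, \<sigma> a') \<in> H" "(a', \<sigma> a) \<in> H"
    using ne by (auto simp: conflicts_def)
  define Out where "Out = out_walks A H \<sigma> a"
  define In where "In = in_walks A H \<sigma> a"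
  have a_Out: "a \<in> Out" and a_In: "a \<in> In"
    using a by (auto simp: Out_def In_def out_walks_def in_walks_def)
  have sub: "Out \<subseteq> A" "In \<subseteq> A"
    by (auto simp: Out_def In_def out_walks_def in_walks_def)
  then have fin': "finite Out" "finite In"
    using fin finite_subset by auto
  have "card (Out \<inter> In) > 0"
    using a_Out a_In fin' by (auto simp: card_gt_0_iff)
  moreover have "card Out \<le> s + s * s" "card In \<le> s + s * s"
    unfolding Out_def In_def
    using card_out_walks_le[OF fin bij a(1) degA] card_in_walks_le[OF fin bij a(1) degB] by auto
  ultimately have "card (Out \<union> In) < card A"
    using card_Un_Int[OF fin'] large by (simp add: algebra_simps)
  then have "Out \<union> In \<noteq> A"
    by auto
  then obtain c where c: "c \<in> A" "c \<notin> Out" "c \<notin> In"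
    using sub by blast
  then have "c \<noteq> a"
    using a_Out by auto
  define \<tau> where "\<tau> = \<sigma>(a := \<sigma> c, c := \<sigma> a)"
  have bij': "bij_betw \<tau> A B"
    using bij a(1) c(1) unfolding \<tau>_def bij_betw_def inj_on_def
    by (auto simp: image_iff)
  note swap = conflicts_swap[OF a(1) c(1) c(2,3)[unfolded Out_def In_def] \<open>c \<noteq> a\<close>,
      folded \<tau>_def]
  have "card (conflicts A H \<tau>) < card (conflicts A H \<sigma>)"
  proof (cases "(a, \<sigma> a) \<in> H \<and> (c, \<sigma> c) \<in> H")
    case True
    have loops: "{{a}, {c}} \<subseteq> conflicts A H \<sigma>"
      using True a(1) c(1) by (auto simp: conflicts_def)
    have "conflicts A H \<tau> \<subseteq> insert {a, c} (conflicts A H \<sigma> - {{a}, {c}})"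
      using swap by blast
    then have "card (conflicts A H \<tau>) \<le> card (insert {a, c} (conflicts A H \<sigma> - {{a}, {c}}))"
      by (rule card_mono[rotated]) (simp add: finite_conflicts[OF fin])
    also have "\<dots> \<le> Suc (card (conflicts A H \<sigma> - {{a}, {c}}))"
      by (rule card_insert_le_m1) simp_all
    also have "\<dots> = Suc (card (conflicts A H \<sigma>) - 2)"
      using loops \<open>c \<noteq> a\<close> by (subst card_Diff_subset) auto
    also have "\<dots> < card (conflicts A H \<sigma>)"
      using card_mono[OF finite_conflicts[OF fin] loops] \<open>c \<noteq> a\<close> by auto
    finally show ?thesis .
  next
    case False
    have "{a, a'} \<in> conflicts A H \<sigma>"
      using a by (auto simp: conflicts_def)
    moreover have "{a, a'} \<notin> conflicts A H \<tau>" "conflicts A H \<tau> \<subseteq> conflicts A H \<sigma>"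
      using swap False by blast+
    ultimately show ?thesis
      by (intro psubset_card_mono finite_conflicts[OF fin]) blast
  qed
  with bij' show ?thesis
    by blast
qed

lemma conflict_free_bijection_exists:
  assumes fin: "finite A" "finite B" and "card A = card B"
    and deg: "\<And>x. x \<in> A \<Longrightarrow> card {y \<in> B. (x, y) \<in> H} \<le> s"
      "\<And>y. y \<in> B \<Longrightarrow> card {x \<in> A. (x, y) \<in> H} \<le> s"
    and large: "2 * s * (s + 1) \<le> card A"
  shows "\<exists>\<sigma>. bij_betw \<sigma> A B \<and> conflicts A H \<sigma> = {}"
proof -
  obtain \<sigma>0 where "bij_betw \<sigma>0 A B"
    using finite_same_card_bij[OF assms(1-3)] by blast
  then obtain \<sigma> where \<sigma>: "bij_betw \<sigma> A B"
    and least: "\<And>\<tau>. bij_betw \<tau> A B \<Longrightarrow> card (conflicts A H \<sigma>) \<le> card (conflicts A H \<tau>)"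
    using ex_has_least_nat[of "\<lambda>\<sigma>. bij_betw \<sigma> A B" \<sigma>0 "\<lambda>\<sigma>. card (conflicts A H \<sigma>)"] by blast
  have "conflicts A H \<sigma> = {}"
    using swap_reduces_conflicts[OF fin(1) \<sigma> deg large] least by (meson not_le)
  with \<sigma> show ?thesis
    by blast
qed

lemma acceptable_matching_exists:
  assumes "finite A" "finite B" and "card A = card B"
    and "\<And>x. x \<in> A \<Longrightarrow> card {y \<in> B. (x, y) \<in> H} \<le> s"
      "\<And>y. y \<in> B \<Longrightarrow> card {x \<in> A. (x, y) \<in> H} \<le> s"
    and "2 * s * (s + 1) \<le> card A"
  shows "\<exists>M. perfect_matching_in A B (bipartite_complement A B H) M \<and> acceptable_for H M"
proof -
  obtain \<sigma> where \<sigma>: "bij_betw \<sigma> A B" and "conflicts A H \<sigma> = {}"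
    using conflict_free_bijection_exists[OF assms] by blast
  then have free: "\<not> ((x, \<sigma> y) \<in> H \<and> (y, \<sigma> x) \<in> H)" if "x \<in> A" "y \<in> A" for x y
    using that by (auto simp: conflicts_def)
  define M where "M = {(x, \<sigma> x) | x. x \<in> A}"
  have "M \<subseteq> bipartite_complement A B H"
    using \<sigma> free by (auto simp: M_def bipartite_complement_def bij_betw_def)
  moreover have "\<exists>!x. (x, y) \<in> M" if "y \<in> B" for y
    using \<sigma> that by (auto simp: M_def bij_betw_def inj_on_def)
  ultimately have "perfect_matching_in A B (bipartite_complement A B H) M"
    by (auto simp: perfect_matching_in_def M_def)
  moreover have "acceptable_for H M"
    using free by (auto simp: acceptable_for_def M_def)
  ultimately show ?thesis
    by blast
qed

lemma bad_regular_graph_degree: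
  assumes "has_bad_regular_graph n s"
  shows "n < 2 * s * (s + 1)"
proof (rule ccontr)
  assume "\<not> n < 2 * s * (s + 1)"
  moreover obtain H :: "(nat \<times> nat) set" where "regular_bipartite_graph {..<n} {..<n} s H"
    and "\<not> (\<exists>M. perfect_matching_in {..<n} {..<n} (bipartite_complement {..<n} {..<n} H) M \<and>
               acceptable_for H M)"
    using assms by (auto simp: has_bad_regular_graph_def)
  ultimately show False
    using acceptable_matching_exists[of "{..<n}" "{..<n}" H s]
    by (simp add: regular_bipartite_graph_def not_less del: lessThan_iff)
qed

lemma b_lower_bound:
  assumes "n > 0"
  shows "real (b n) > 1 / 2 * (sqrt (2 * real n + 1) - 1)"
proof -
  have "n < 2 * b n * (b n + 1)"
    using bad_regular_graph_degree[OF b_attained[OF assms]] .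
  then have "real n < real (2 * b n * (b n + 1))"
    by (simp only: of_nat_less_iff)
  then have "2 * real n + 1 < (2 * real (b n) + 1)\<^sup>2"
    by (simp add: power2_eq_square algebra_simps)
  then have "sqrt (2 * real n + 1) < 2 * real (b n) + 1"
    by (intro real_less_lsqrt) auto
  then show ?thesis
    by simp
qed

theorem corollary7:
  "\<exists>\<epsilon> :: nat \<Rightarrow> real. \<epsilon> \<longlonglongrightarrow> 0 \<and>
     (\<forall>n\<ge>1. real (b n) > 1 / 2 * (sqrt (2 * real n + 1) - 1) \<and>
            1 / 2 * (sqrt (2 * real n + 1) - 1) = (1 / sqrt 2 + \<epsilon> n) * real n powr (1 / 2))"
proof (intro exI conjI allI impI)
  let ?\<epsilon> = "\<lambda>n. 1 / 2 * (sqrt (2 * real n + 1) - 1) / real n powr (1 / 2) - 1 / sqrt 2"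
  have "(\<lambda>n. 1 / 2 * (sqrt (2 * real n + 1) - 1) / real n powr (1 / 2)) \<longlonglongrightarrow> sqrt 2 / 2"
    by (real_asymp simp: powr_half_sqrt)
  moreover have "sqrt 2 / 2 = 1 / sqrt (2 :: real)"
    by (simp add: field_simps)
  ultimately show "?\<epsilon> \<longlonglongrightarrow> 0"
    by (simp only: LIM_zero_iff)
  fix n :: nat
  assume "n \<ge> 1"
  then show "real (b n) > 1 / 2 * (sqrt (2 * real n + 1) - 1)"
    by (intro b_lower_bound) simp
  show "1 / 2 * (sqrt (2 * real n + 1) - 1) = (1 / sqrt 2 + ?\<epsilon> n) * real n powr (1 / 2)"
    using \<open>n \<ge> 1\<close> by simp
qed

end
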